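(* Let $P(X)\in\mathbb{Z}[X]$ be a polynomial of degree $d$, and assume $d\ge 2$. Let $\Psi:\mathbb{R}_+\to\mathbb{R}_+$ be a decreasing function which tends to zero at infinity, and let $\lambda_{\Psi}$ be the lower order of $1/\Psi$. If $\lambda_{\Psi}>d+1$, then $$W_{\Psi}(P_{\alpha})=\emptyset$$ for almost all $\alpha\in\mathbb{R}$. Furthermore, if $\lambda_{\Psi}\in(d,d+1]$, then $$\dim W_{\Psi}(P_{\alpha})\le\frac{d+1-\lambda_{\Psi}}{\lambda_{\Psi}}$$ for almost all $\alpha\in\mathbb{R}$.
   Context: For a real number $\alpha$, $W_{\Psi}(P_{\alpha})$ denotes the set of all $x\in\mathbb{R}$ such that $$\left|x-\frac{p}{q}\right|<\Psi(q)\quad\text{and}\quad\left|P(x)+\alpha-\frac{r}{q}\right|<\Psi(q)$$ for infinitely many triples of integers $(p,r,q)$ with $q\ge 1$. The lower order of $1/\Psi$ is $$\lambda_{\Psi}:=\liminf_{q\to\infty}\frac{-\log\Psi(q)}{\log q}.$$ $\dim$ denotes Hausdorff dimension (with the usual convention $\dim\emptyset=0$). "Almost all" means that the set of exceptions has Lebesgue measure zero. *)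

theory Defs
  imports "HOL-Analysis.Analysis" "HOL-Computational_Algebra.Polynomial"
begin

text \<open>
  The term contributed by a set \<open>U\<close> to an \<open>s\<close>-dimensional covering sum. Since
  \<open>0 powr 0 = 0\<close> in HOL, the case \<open>s = 0\<close> is treated separately, so that the
  \<open>0\<close>-dimensional Hausdorff measure is counting measure.
\<close>

definition diam_pow :: "real \<Rightarrow> 'a::metric_space set \<Rightarrow> ennreal" where
  "diam_pow s U = (if U = {} then 0 else if s = 0 then 1 else ennreal (diameter U powr s))"

text \<open>
  Covers are indexed by \<open>nat\<close>; finite covers are included by padding with empty sets.
  Boundedness is required because \<open>diameter\<close> is only meaningful for bounded sets.
\<close>

definition hausdorff_premeasure :: "real \<Rightarrow> real \<Rightarrow> 'a::metric_space set \<Rightarrow> ennreal" where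
  "hausdorff_premeasure \<delta> s A =
     (INF U \<in> {U :: nat \<Rightarrow> 'a set. A \<subseteq> (\<Union>i. U i) \<and> (\<forall>i. bounded (U i) \<and> diameter (U i) \<le> \<delta>)}.
        (\<Sum>i. diam_pow s (U i)))"

definition hausdorff_measure :: "real \<Rightarrow> 'a::metric_space set \<Rightarrow> ennreal" where
  "hausdorff_measure s A = (SUP \<delta> \<in> {0<..}. hausdorff_premeasure \<delta> s A)"

definition hausdorff_dim :: "'a::metric_space set \<Rightarrow> ereal" where
  "hausdorff_dim A = Inf {ereal s | s. 0 \<le> s \<and> hausdorff_measure s A = 0}"

lemma hausdorff_dim_empty: "hausdorff_dim ({} :: 'a::metric_space set) = 0"
proof -
  have "hausdorff_premeasure \<delta> 0 ({} :: 'a set) = 0" if "\<delta> > 0" for \<delta>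
  proof -
    have "hausdorff_premeasure \<delta> 0 ({} :: 'a set) \<le> (\<Sum>i::nat. diam_pow 0 ({} :: 'a set))"
      unfolding hausdorff_premeasure_def
      by (rule INF_lower2[of "\<lambda>_. {}"]) (use that in \<open>auto simp: diameter_def\<close>)
    then show ?thesis by (simp add: diam_pow_def)
  qed
  then have "hausdorff_measure 0 ({} :: 'a set) = 0"
    unfolding hausdorff_measure_def by (auto simp: image_constant_conv bot_ennreal intro!: antisym SUP_least)
  then have "hausdorff_dim ({} :: 'a set) \<le> 0"
    unfolding hausdorff_dim_def by (intro Inf_lower) (auto simp: zero_ereal_def)
  moreover have "0 \<le> hausdorff_dim ({} :: 'a set)"
    unfolding hausdorff_dim_def by (rule Inf_greatest) auto
  ultimately show ?thesis by (rule antisym)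
qed

text \<open>
  The lower order of \<open>1/\<Psi>\<close>, meant for \<open>\<Psi>\<close> positive on the positive reals. It is
  extended-real-valued: the value \<open>\<infinity>\<close> is possible.
\<close>

definition lower_order_inverse :: "(real \<Rightarrow> real) \<Rightarrow> ereal" where
  "lower_order_inverse \<Psi> = Liminf at_top (\<lambda>q::real. ereal (- ln (\<Psi> q) / ln q))"

definition W :: "(real \<Rightarrow> real) \<Rightarrow> int poly \<Rightarrow> real \<Rightarrow> real set" where
  "W \<Psi> P \<alpha> = {x. infinite {(p::int, r::int, q::int). q \<ge> 1 \<and>
      \<bar>x - of_int p / of_int q\<bar> < \<Psi> (of_int q) \<and>
      \<bar>poly (map_poly real_of_int P) x + \<alpha> - of_int r / of_int q\<bar> < \<Psi> (of_int q)}}"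

end

theory Submission
  imports Defs
begin

text \<open>
  If \<open>(p, r, q)\<close> is admissible for \<open>x\<close> in a bounded interval, then, since \<open>P\<close> is Lipschitz there,
  \<open>\<alpha>\<close> lies within \<open>C \<Psi>(q)\<close> of \<open>r/q - P(p/q)\<close>. Only \<open>O(q\<^sup>2)\<close> pairs \<open>(p, r)\<close> matter for each \<open>q\<close>, so
  the integral over \<open>\<alpha>\<close> of the \<open>s\<close>-dimensional covering sum of \<open>W(P\<^sub>\<alpha>)\<close> by the balls \<open>B(p/q, \<Psi>(q))\<close> is
  at most a constant times the sum of \<open>q\<^sup>2 \<Psi>(q)\<^bsup>1+s\<^esup>\<close>, which converges as soon as \<open>\<lambda> (1 + s) > 3\<close>. By
  the Hausdorff--Cantelli lemma the \<open>s\<close>-dimensional Hausdorff measure of \<open>W(P\<^sub>\<alpha>)\<close> then vanishes for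
  almost every \<open>\<alpha>\<close>. As \<open>d + 1 \<ge> 3\<close>, this covers \<open>s = 0\<close> when \<open>\<lambda> > d + 1\<close> (a set of zero counting
  measure is empty) and every \<open>s > (d + 1 - \<lambda>)/\<lambda>\<close> otherwise.
\<close>

section \<open>Covers and null sets of Hausdorff measure\<close>

lemma hausdorff_premeasure_le:
  assumes "A \<subseteq> (\<Union>i. U i)" "\<And>i::nat. bounded (U i)" "\<And>i. diameter (U i) \<le> \<delta>"
  shows "hausdorff_premeasure \<delta> s A \<le> (\<Sum>i. diam_pow s (U i))"
  unfolding hausdorff_premeasure_def by (rule INF_lower) (use assms in auto)

lemma hausdorff_measure_eq_0_iff:
  "hausdorff_measure s A = 0 \<longleftrightarrow> (\<forall>\<delta>>0. hausdorff_premeasure \<delta> s A = 0)"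
  unfolding hausdorff_measure_def using SUP_eq_iff[of "{0::real<..}" 0]
  by (auto simp: SUP_bot_conv bot_ennreal[symmetric])

lemma hausdorff_premeasure_coverE:
  assumes "hausdorff_premeasure \<delta> s A < c"
  obtains U where "A \<subseteq> (\<Union>i. U i)" "\<And>i::nat. bounded (U i)" "\<And>i. diameter (U i) \<le> \<delta>"
    "(\<Sum>i. diam_pow s (U i)) < c"
  using assms unfolding hausdorff_premeasure_def INF_less_iff by auto

text \<open>Cover the \<open>n\<close>-th set with covering sum below \<open>e / 2^(n+1)\<close> and
  enumerate the resulting double family by \<open>prod_decode\<close>; the total is at most
  \<open>e\<close>. This later assembles \<open>W\<close> from its bounded pieces.\<close>

lemma hausdorff_measure_0_UN:
  fixes A :: "nat \<Rightarrow> 'a::metric_space set"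
  assumes "\<And>n. hausdorff_measure s (A n) = 0"
  shows "hausdorff_measure s (\<Union>n. A n) = 0"
  unfolding hausdorff_measure_eq_0_iff
proof (intro allI impI)
  fix \<delta> :: real assume "\<delta> > 0"
  have "hausdorff_premeasure \<delta> s (\<Union>n. A n) \<le> 0 + ennreal e" if "e > 0" for e
  proof -
    have "\<exists>U. A n \<subseteq> (\<Union>i. U i) \<and> (\<forall>i::nat. bounded (U i)) \<and> (\<forall>i. diameter (U i) \<le> \<delta>) \<and>
        (\<Sum>i. diam_pow s (U i)) < ennreal (e * (1/2) ^ Suc n)" for n
    proof -
      have "hausdorff_premeasure \<delta> s (A n) < ennreal (e * (1/2) ^ Suc n)"
        using assms[of n] \<open>\<delta> > 0\<close> \<open>e > 0\<close> by (auto simp: hausdorff_measure_eq_0_iff)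
      then show ?thesis by (elim hausdorff_premeasure_coverE) blast
    qed
    then obtain U where U: "\<And>n. A n \<subseteq> (\<Union>i. U n i)" "\<And>n i::nat. bounded (U n i)"
        "\<And>n i. diameter (U n i) \<le> \<delta>"
        "\<And>n. (\<Sum>i. diam_pow s (U n i)) < ennreal (e * (1/2) ^ Suc n)"
      by metis
    let ?V = "\<lambda>k. case prod_decode k of (n, i) \<Rightarrow> U n i"
    have "hausdorff_premeasure \<delta> s (\<Union>n. A n) \<le> (\<Sum>k. diam_pow s (?V k))"
    proof (rule hausdorff_premeasure_le)
      show "(\<Union>n. A n) \<subseteq> (\<Union>k. ?V k)"
      proof
        fix x assume "x \<in> (\<Union>n. A n)"
        then obtain n i where "x \<in> U n i" using U(1) by blast
        then have "x \<in> ?V (prod_encode (n, i))" by simp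
        then show "x \<in> (\<Union>k. ?V k)" by (rule UN_I[OF UNIV_I])
      qed
    qed (simp_all add: U(2,3) split: prod.split)
    also have "\<dots> = (\<Sum>n. \<Sum>i. diam_pow s (U n i))"
      using suminf_ennreal_2dimen[of "\<lambda>n. \<Sum>i. diam_pow s (U n i)"
          "\<lambda>(n, i). diam_pow s (U n i)"]
      by (simp add: case_prod_unfold)
    also have "\<dots> \<le> (\<Sum>n. ennreal (e * (1/2) ^ Suc n))"
      by (intro suminf_le) (use U(4) in \<open>auto intro: less_imp_le\<close>)
    also have "\<dots> = ennreal (e * 1)"
      using \<open>e > 0\<close>
      by (intro suminf_ennreal_eq sums_mult power_half_series) auto
    finally show ?thesis by simp
  qed
  then have "hausdorff_premeasure \<delta> s (\<Union>n. A n) \<le> 0"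
    by (rule ennreal_le_epsilon)
  then show "hausdorff_premeasure \<delta> s (\<Union>n. A n) = 0" by simp
qed

lemma hausdorff_measure_0_mono:
  assumes "hausdorff_measure s B = 0" "A \<subseteq> B"
  shows "hausdorff_measure s A = 0"
  unfolding hausdorff_measure_eq_0_iff
proof (intro allI impI)
  fix \<delta> :: real assume "\<delta> > 0"
  have "hausdorff_premeasure \<delta> s A \<le> hausdorff_premeasure \<delta> s B"
    unfolding hausdorff_premeasure_def by (rule INF_superset_mono) (use assms(2) in auto)
  then show "hausdorff_premeasure \<delta> s A = 0"
    using assms(1) \<open>\<delta> > 0\<close> by (auto simp: hausdorff_measure_eq_0_iff)
qed

text \<open>In dimension 0 every nonempty covering set contributes 1, so a covering sum below 1
  consists of empty sets only.\<close>

lemma empty_if_hausdorff_measure_0_eq_0: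
  assumes "hausdorff_measure 0 A = 0"
  shows "A = {}"
proof (rule ccontr)
  assume "A \<noteq> {}"
  have "hausdorff_premeasure 1 0 A < 1"
    using assms by (auto simp: hausdorff_measure_eq_0_iff)
  then obtain U where U: "A \<subseteq> (\<Union>i. U i)" "(\<Sum>i. diam_pow 0 (U i)) < 1"
    by (elim hausdorff_premeasure_coverE)
  from U(1) \<open>A \<noteq> {}\<close> obtain i where "U i \<noteq> {}" by blast
  then have "diam_pow 0 (U i) = 1" by (simp add: diam_pow_def)
  with ennreal_suminf_lessD[OF U(2), of i] show False by simp
qed

section \<open>The Hausdorff--Cantelli lemma\<close>

text \<open>Every tail of the family covers the limsup set, and the tail sums of a convergent series
  tend to 0.\<close>

lemma hausdorff_Cantelli_nat:
  fixes U :: "nat \<Rightarrow> 'a::metric_space set"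
  assumes bdd: "\<And>i. bounded (U i)" and "s \<ge> 0" and fin: "(\<Sum>i. diam_pow s (U i)) < \<infinity>"
  shows "hausdorff_measure s {x. infinite {i. x \<in> U i}} = 0"
  unfolding hausdorff_measure_eq_0_iff
proof (intro allI impI)
  fix \<delta> :: real assume "\<delta> > 0"
  define c where "c = (\<lambda>i. enn2real (diam_pow s (U i)))"
  have c: "diam_pow s (U i) = ennreal (c i)" for i
    using ennreal_suminf_lessD[OF fin, of i] by (simp add: c_def)
  have c0: "c i \<ge> 0" for i by (simp add: c_def)
  have sc: "summable c"
    using fin by (intro summable_suminf_not_top) (auto simp: c c0)
  \<comment> \<open>Small terms make the tail an admissible cover: a set of diameter above
    \<open>\<delta>\<close> would have \<open>c i \<ge> \<delta> powr s\<close>. This also works for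
    \<open>s = 0\<close>, where \<open>\<delta> powr 0 = 1\<close> and \<open>c i < 1\<close> means
    that \<open>U i\<close> is empty.\<close>
  have "eventually (\<lambda>i. c i < \<delta> powr s) sequentially"
    using summable_LIMSEQ_zero[OF sc] \<open>\<delta> > 0\<close> by (intro order_tendstoD) auto
  then obtain m0 where m0: "\<And>i. i \<ge> m0 \<Longrightarrow> c i < \<delta> powr s"
    by (auto simp: eventually_sequentially)
  have diam: "diameter (U i) \<le> \<delta>" if "i \<ge> m0" for i
  proof (rule ccontr)
    assume *: "\<not> diameter (U i) \<le> \<delta>"
    then have ne: "U i \<noteq> {}" using \<open>\<delta> > 0\<close> by auto
    have "\<delta> powr s \<le> diameter (U i) powr s"
      using * \<open>\<delta> > 0\<close> \<open>s \<ge> 0\<close> by (intro powr_mono2) auto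
    also have "\<dots> = c i"
      using ne * \<open>\<delta> > 0\<close> by (auto simp: c_def diam_pow_def)
    finally show False using m0[OF that] by simp
  qed
  have "hausdorff_premeasure \<delta> s {x. infinite {i. x \<in> U i}} \<le> 0 + ennreal e" if "e > 0" for e
  proof -
    have "eventually (\<lambda>m. (\<Sum>k. c (k + m)) < e \<and> m \<ge> m0) sequentially"
      using suminf_exist_split2[OF sc] \<open>e > 0\<close>
      by (intro eventually_conj order_tendstoD eventually_ge_at_top) auto
    then obtain m where m: "m \<ge> m0" "(\<Sum>k. c (k + m)) < e"
      unfolding eventually_sequentially by blast
    have "hausdorff_premeasure \<delta> s {x. infinite {i. x \<in> U i}} \<le> (\<Sum>k. diam_pow s (U (k + m)))"
    proof (rule hausdorff_premeasure_le)
      show "{x. infinite {i. x \<in> U i}} \<subseteq> (\<Union>k. U (k + m))"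
      proof safe
        fix x assume "infinite {i. x \<in> U i}"
        then obtain i where "i \<ge> m" "x \<in> U i" by (auto simp: infinite_nat_iff_unbounded_le)
        then have "x \<in> U ((i - m) + m)" by simp
        then show "x \<in> (\<Union>k. U (k + m))" by blast
      qed
    qed (use bdd diam m in auto)
    also have "\<dots> = ennreal (\<Sum>k. c (k + m))"
      unfolding c by (rule suminf_ennreal2) (use c0 sc in \<open>auto simp: summable_iff_shift\<close>)
    also have "\<dots> \<le> ennreal e" using m by (intro ennreal_leI) auto
    finally show ?thesis by simp
  qed
  then have "hausdorff_premeasure \<delta> s {x. infinite {i. x \<in> U i}} \<le> 0"
    by (rule ennreal_le_epsilon)
  then show "hausdorff_premeasure \<delta> s {x. infinite {i. x \<in> U i}} = 0" by simp
qed

lemma hausdorff_Cantelli: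
  fixes U :: "'i::countable \<Rightarrow> 'a::metric_space set"
  assumes bdd: "\<And>i. bounded (U i)" and "s \<ge> 0"
    and fin: "(\<integral>\<^sup>+ i. diam_pow s (U i) \<partial>count_space UNIV) < \<infinity>"
  shows "hausdorff_measure s {x. infinite {i. x \<in> U i}} = 0"
proof -
  \<comment> \<open>The index type may be finite, so \<open>to_nat\<close> need not be onto. Indices
    outside its range get the empty set, which contributes 0 to the sum.\<close>
  define V where "V = (\<lambda>n. if n \<in> range (to_nat :: 'i \<Rightarrow> nat) then U (from_nat n) else {})"
  have "(\<Sum>n. diam_pow s (V n)) = (\<integral>\<^sup>+ n. diam_pow s (V n) \<partial>count_space UNIV)"
    by (rule nn_integral_count_space_nat[symmetric])
  also have "\<dots> = (\<integral>\<^sup>+ n. diam_pow s (V n) \<partial>count_space (range (to_nat :: 'i \<Rightarrow> nat)))"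
    by (intro nn_integral_count_space_eq) (auto simp: V_def diam_pow_def)
  also have "\<dots> = (\<integral>\<^sup>+ i. diam_pow s (V (to_nat (i::'i))) \<partial>count_space UNIV)"
    by (intro nn_integral_bij_count_space[symmetric] inj_on_imp_bij_betw) auto
  also have "\<dots> = (\<integral>\<^sup>+ i. diam_pow s (U i) \<partial>count_space UNIV)"
    by (simp add: V_def)
  finally have "(\<Sum>n. diam_pow s (V n)) < \<infinity>" using fin by simp
  moreover have "bounded (V n)" for n using bdd by (simp add: V_def)
  ultimately have "hausdorff_measure s {x. infinite {n. x \<in> V n}} = 0"
    using \<open>s \<ge> 0\<close> by (intro hausdorff_Cantelli_nat) auto
  moreover have "{x. infinite {i. x \<in> U i}} \<subseteq> {x. infinite {n. x \<in> V n}}"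
  proof safe
    fix x assume inf: "infinite {i. x \<in> U i}" and fin: "finite {n. x \<in> V n}"
    have "to_nat ` {i. x \<in> U i} \<subseteq> {n. x \<in> V n}" by (auto simp: V_def)
    with fin have "finite (to_nat ` {i. x \<in> U i})" by (rule rev_finite_subset)
    then have "finite {i. x \<in> U i}" by (rule finite_imageD) simp
    with inf show False by simp
  qed
  ultimately show ?thesis by (rule hausdorff_measure_0_mono)
qed

section \<open>Convergence of the covering series\<close>

text \<open>For \<open>\<mu>\<close> strictly below the lower order, \<Psi>(q) <
  \<open>q powr (-\<mu>)\<close> for all large q. The terms are then at most q to the power 2 -
  \<mu>(1 + s), and this exponent is below -1 as soon as \<mu> > 3/(1 + s).\<close>

lemma summable_lower_order:
  fixes \<Psi> :: "real \<Rightarrow> real"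
  assumes pos: "\<And>x. x > 0 \<Longrightarrow> \<Psi> x > 0" and "s \<ge> 0"
    and lo: "ereal (3 / (1 + s)) < lower_order_inverse \<Psi>"
  shows "summable (\<lambda>n. real (Suc n) ^ 2 * \<Psi> (real (Suc n)) powr (1 + s))"
proof -
  obtain \<mu> where \<mu>: "3 / (1 + s) < \<mu>" "ereal \<mu> < lower_order_inverse \<Psi>"
    using ereal_dense2[OF lo] by auto
  define a where "a = 2 - \<mu> * (1 + s)"
  have a: "a < -1" using \<mu>(1) \<open>s \<ge> 0\<close> by (simp add: a_def field_simps)
  have "eventually (\<lambda>q::real. ereal \<mu> < ereal (- ln (\<Psi> q) / ln q)) at_top"
    using \<mu>(2) unfolding lower_order_inverse_def by (rule less_LiminfD)
  then have ev: "eventually (\<lambda>q::real. q ^ 2 * \<Psi> q powr (1 + s) \<le> q powr a) at_top"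
    using eventually_gt_at_top[of 1]
  proof eventually_elim
    case (elim q)
    then have "ln (\<Psi> q) < - \<mu> * ln q" by (simp add: field_simps)
    then have "(1 + s) * ln (\<Psi> q) \<le> (1 + s) * (- \<mu> * ln q)"
      using \<open>s \<ge> 0\<close> by (intro mult_left_mono) auto
    then have "\<Psi> q powr (1 + s) \<le> q powr (- \<mu> * (1 + s))"
      using elim pos[of q] by (simp add: powr_def algebra_simps)
    then have "q ^ 2 * \<Psi> q powr (1 + s) \<le> q powr 2 * q powr (- \<mu> * (1 + s))"
      using elim by (intro mult_mono) (auto simp: powr_numeral)
    also have "\<dots> = q powr a" by (simp add: a_def powr_add[symmetric])
    finally show ?case .
  qed
  have "eventually (\<lambda>n. real (Suc n) ^ 2 * \<Psi> (real (Suc n)) powr (1 + s) \<le> real (Suc n) powr a)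
      sequentially"
    by (rule eventually_compose_filterlim[OF ev])
       (rule filterlim_compose[OF filterlim_real_sequentially filterlim_Suc])
  then have "eventually (\<lambda>n. norm (real (Suc n) ^ 2 * \<Psi> (real (Suc n)) powr (1 + s))
      \<le> real (Suc n) powr a) sequentially"
    by (rule eventually_mono) simp
  moreover have "summable (\<lambda>n. real (Suc n) powr a)"
    using a by (subst summable_Suc_iff[of "\<lambda>n. real n powr a"]) (simp add: summable_real_powr_iff)
  ultimately show ?thesis by (rule summable_comparison_test_ev)
qed

section \<open>Resonant triples and integration over \<alpha>\<close>

text \<open>The fractions \<open>p/q\<close> and \<open>r/q\<close> are confined to
  \<open>[-K, K]\<close>, which leaves finitely many numerators for each denominator.\<close>

definition admissible_box :: "int \<Rightarrow> int \<times> int \<times> int \<Rightarrow> bool" where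
  "admissible_box K = (\<lambda>(p, r, q). q \<ge> 1 \<and> \<bar>p\<bar> \<le> K * q \<and> \<bar>r\<bar> \<le> K * q)"

text \<open>For fixed \<open>q\<close> there are \<open>(2Kq + 1)^2\<close> pairs
  \<open>(p, r)\<close>, at most \<open>9 K^2 q^2\<close> because \<open>Kq \<ge> 1\<close>; the sum
  over triples is thus dominated by the given series.\<close>

lemma nn_integral_admissible_box_finite:
  fixes h :: "real \<Rightarrow> real"
  assumes "K \<ge> 1" and nonneg: "\<And>x. h x \<ge> 0"
    and sum: "summable (\<lambda>n. real (Suc n) ^ 2 * h (real (Suc n)))"
  shows "(\<integral>\<^sup>+ (p, r, q). ennreal (h (of_int q)) * indicator (Collect (admissible_box K)) (p, r, q)
            \<partial>count_space UNIV) < \<infinity>"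
proof -
  let ?f = "\<lambda>(p, r, q). ennreal (h (of_int q)) * indicator (Collect (admissible_box K)) (p, r, q)"
  let ?I = "\<lambda>q. {- (K * q)..K * q}"
  \<comment> \<open>Once the indicator is a product, the sums over \<open>p\<close> and
    \<open>r\<close> separate, and each gives the cardinality of \<open>?I q\<close>.\<close>
  have split: "?f (p, r, q) =
      ennreal (h (of_int q)) * indicator {1..} q * indicator (?I q) r * indicator (?I q) p" for p r q
    by (auto simp: admissible_box_def indicator_def abs_le_iff)
  have card: "emeasure (count_space UNIV) (?I q) = ennreal (of_int (2 * K * q + 1))" if "q \<ge> 1" for q
  proof -
    have "K * q \<ge> 0" using \<open>K \<ge> 1\<close> that by simp
    then show ?thesis by (simp add: ennreal_of_nat_eq_real_of_nat mult.assoc)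
  qed
  have "(\<integral>\<^sup>+ i. ?f i \<partial>count_space UNIV) =
      (\<integral>\<^sup>+ q. \<integral>\<^sup>+ r. \<integral>\<^sup>+ p. ?f (p, r, q) \<partial>count_space UNIV \<partial>count_space UNIV \<partial>count_space UNIV)"
    using nn_integral_snd_count_space[of ?f]
      nn_integral_snd_count_space[of "\<lambda>(r, q). \<integral>\<^sup>+ p. ?f (p, r, q) \<partial>count_space UNIV"]
    by (simp add: case_prod_unfold)
  also have "\<dots> = (\<integral>\<^sup>+ q. ennreal (h (of_int q)) * indicator {1..} q *
      emeasure (count_space UNIV) (?I q) * emeasure (count_space UNIV) (?I q) \<partial>count_space UNIV)"
    unfolding split
    by (simp add: nn_integral_cmult nn_integral_multc mult.assoc)
  also have "\<dots> \<le> (\<integral>\<^sup>+ q. ennreal (9 * (of_int K)\<^sup>2 * ((of_int q)\<^sup>2 * h (of_int q))) * indicator {1..} q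
      \<partial>count_space UNIV)"
  proof (intro nn_integral_mono)
    fix q :: int
    show "ennreal (h (of_int q)) * indicator {1..} q * emeasure (count_space UNIV) (?I q) *
        emeasure (count_space UNIV) (?I q)
      \<le> ennreal (9 * (of_int K)\<^sup>2 * ((of_int q)\<^sup>2 * h (of_int q))) * indicator {1..} q"
    proof (cases "q \<ge> 1")
      case True
      have "1 * 1 \<le> K * q" using \<open>K \<ge> 1\<close> True by (intro mult_mono) auto
      then have b: "2 * K * q + 1 \<le> 3 * (K * q)" "2 * K * q + 1 \<ge> 0" by auto
      define u v where "u = real_of_int (2 * K * q + 1)" and "v = real_of_int (3 * (K * q))"
      have uv: "0 \<le> u" "u \<le> v" unfolding u_def v_def using b by (simp_all only: of_int_le_iff of_int_0_le_iff)
      have "h (of_int q) * u * u \<le> h (of_int q) * v * v"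
        using uv nonneg by (intro mult_mono) auto
      also have "\<dots> = 9 * (of_int K)\<^sup>2 * ((of_int q)\<^sup>2 * h (of_int q))"
        by (simp add: v_def power2_eq_square)
      finally show ?thesis
        unfolding card[OF True] u_def[symmetric]
        using True nonneg uv by (simp add: ennreal_mult[symmetric])
    qed auto
  qed
  also have "\<dots> = (\<integral>\<^sup>+ q. ennreal (9 * (of_int K)\<^sup>2 * ((of_int q)\<^sup>2 * h (of_int q))) \<partial>count_space {1..})"
    by (subst nn_integral_count_space_indicator) auto
  also have "\<dots> = (\<integral>\<^sup>+ n. ennreal (9 * (of_int K)\<^sup>2 * ((real (Suc n))\<^sup>2 * h (real (Suc n)))) \<partial>count_space UNIV)"
  proof (subst nn_integral_bij_count_space[symmetric])
    show "bij_betw (\<lambda>n. int (Suc n)) UNIV {1..}"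
      by (rule bij_betwI[where g = "\<lambda>q. nat (q - 1)"]) auto
  qed simp
  also have "\<dots> = (\<Sum>n. ennreal (9 * (of_int K)\<^sup>2 * ((real (Suc n))\<^sup>2 * h (real (Suc n)))))"
    by (rule nn_integral_count_space_nat)
  also have "\<dots> < \<infinity>"
    unfolding infinity_ennreal_def less_top[symmetric]
    by (intro ennreal_suminf_neq_top summable_mult sum mult_nonneg_nonneg zero_le_power2 nonneg) simp
  finally show ?thesis .
qed

text \<open>By Tonelli, the integral over \<alpha> of the covering sum equals the sum over triples
  of (ball diameter)^s times the measure of the set of \<alpha> for which the triple is active. It
  is finite, so the covering sum is finite for almost every \<alpha>, and Hausdorff--Cantelli
  applies.\<close>

lemma AE_hausdorff_measure_resonant_0:
  fixes f \<Psi> :: "real \<Rightarrow> real"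
  assumes pos: "\<And>x. x > 0 \<Longrightarrow> \<Psi> x > 0" and "s \<ge> 0" "C > 0" "K \<ge> 1"
    and sum: "summable (\<lambda>n. real (Suc n) ^ 2 * \<Psi> (real (Suc n)) powr (1 + s))"
  shows "AE \<alpha> in lborel. hausdorff_measure s
    {x. infinite {(p, r, q). admissible_box K (p, r, q) \<and> \<bar>x - of_int p / of_int q\<bar> < \<Psi> (of_int q) \<and>
        \<bar>f (of_int p / of_int q) + \<alpha> - of_int r / of_int q\<bar> < C * \<Psi> (of_int q)}} = 0"
proof -
  \<comment> \<open>\<open>E (p, r, q)\<close> is the interval of \<alpha> that satisfy the second
    inequality; \<open>U \<alpha>\<close> keeps the ball of \<open>x\<close> around
    \<open>p/q\<close> exactly for the triples in the box that are active at \<alpha>.\<close>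
  define E where "E = (\<lambda>(p::int, r::int, q::int).
    ball (of_int r / of_int q - f (of_int p / of_int q)) (C * \<Psi> (of_int q)))"
  define U where "U = (\<lambda>\<alpha> (p, r, q). if admissible_box K (p, r, q) \<and> \<alpha> \<in> E (p, r, q)
    then ball (of_int p / of_int q :: real) (\<Psi> (of_int q)) else {})"
  define g where "g = (\<lambda>(p, r, q). ennreal ((2 * \<Psi> (of_int q)) powr s) *
    indicator (Collect (admissible_box K)) (p, r, q))"
  \<comment> \<open>Only the indicator depends on \<alpha>. Positivity of \<Psi>(q) in the box makes
    the ball nonempty and \<open>(2 * \<Psi> (of_int q)) powr 0 = 1\<close>, in agreement with the
    convention of \<open>diam_pow\<close> at \<open>s = 0\<close>.\<close>
  have dp: "diam_pow s (U \<alpha> i) = g i * indicator (E i) \<alpha>" for \<alpha> i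
  proof -
    obtain p r q where i: "i = (p, r, q)" by (cases i)
    have "\<Psi> (of_int q) > 0" if "admissible_box K (p, r, q)"
      using that by (intro pos) (auto simp: admissible_box_def)
    then show ?thesis
      by (auto simp: i diam_pow_def U_def g_def indicator_def)
  qed
  have E: "g i * emeasure lborel (E i) =
      (case i of (p, r, q) \<Rightarrow> ennreal (2 powr s * 2 * C * \<Psi> (of_int q) powr (1 + s)) *
        indicator (Collect (admissible_box K)) (p, r, q))" for i
  proof -
    obtain p r q where i: "i = (p, r, q)" by (cases i)
    show ?thesis
    proof (cases "admissible_box K (p, r, q)")
      case True
      then have \<Psi>: "\<Psi> (of_int q) > 0" by (intro pos) (auto simp: admissible_box_def)
      then have "emeasure lborel (E i) = ennreal (2 * C * \<Psi> (of_int q))"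
        using \<open>C > 0\<close> by (simp add: i E_def ball_eq_greaterThanLessThan)
      then show ?thesis
        using True \<Psi> \<open>C > 0\<close>
        by (simp add: i g_def ennreal_mult[symmetric] powr_add powr_mult mult_ac)
    qed (simp add: i g_def)
  qed
  have E_sets [measurable]: "E i \<in> sets borel" for i by (cases i) (simp add: E_def)
  have meas: "(\<lambda>\<alpha>. g i * indicator (E i) \<alpha>) \<in> borel_measurable lborel" for i
    by measurable
  have "(\<integral>\<^sup>+ \<alpha>. \<integral>\<^sup>+ i. diam_pow s (U \<alpha> i) \<partial>count_space UNIV \<partial>lborel) =
      (\<integral>\<^sup>+ i. \<integral>\<^sup>+ \<alpha>. g i * indicator (E i) \<alpha> \<partial>lborel \<partial>count_space UNIV)"
    unfolding dp by (intro nn_integral_count_space_nn_integral) (use meas in auto)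
  also have "\<dots> = (\<integral>\<^sup>+ i. g i * emeasure lborel (E i) \<partial>count_space UNIV)"
    by (intro nn_integral_cong nn_integral_cmult_indicator) auto
  also have "\<dots> < \<infinity>"
    unfolding E
    by (rule nn_integral_admissible_box_finite)
       (use \<open>C > 0\<close> \<open>K \<ge> 1\<close> summable_mult[OF sum, of "2 powr s * 2 * C"] in \<open>simp_all add: mult_ac\<close>)
  finally have "(\<integral>\<^sup>+ \<alpha>. \<integral>\<^sup>+ i. diam_pow s (U \<alpha> i) \<partial>count_space UNIV \<partial>lborel) \<noteq> \<infinity>"
    by simp
  moreover have "(\<lambda>\<alpha>. \<integral>\<^sup>+ i. diam_pow s (U \<alpha> i) \<partial>count_space UNIV) \<in> borel_measurable lborel"
  proof -
    \<comment> \<open>Enumerating the triples turns the integral into a series of measurable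
      functions, whose sum is measurable.\<close>
    have "(\<lambda>\<alpha>. \<integral>\<^sup>+ i. diam_pow s (U \<alpha> i) \<partial>count_space UNIV) =
        (\<lambda>\<alpha>. \<Sum>n. diam_pow s (U \<alpha> (from_nat_into UNIV n)))"
      by (subst nn_integral_bij_count_space[OF bij_betw_from_nat_into, symmetric])
         (auto simp: nn_integral_count_space_nat infinite_UNIV_char_0 finite_prod)
    moreover have "(\<lambda>\<alpha>. diam_pow s (U \<alpha> i)) \<in> borel_measurable lborel" for i
      unfolding dp by (rule meas)
    ultimately show ?thesis by simp
  qed
  ultimately have "AE \<alpha> in lborel. (\<integral>\<^sup>+ i. diam_pow s (U \<alpha> i) \<partial>count_space UNIV) \<noteq> \<infinity>"
    by (intro nn_integral_PInf_AE)
  then show ?thesis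
  proof eventually_elim
    case (elim \<alpha>)
    have "hausdorff_measure s {x. infinite {i. x \<in> U \<alpha> i}} = 0"
      using elim \<open>s \<ge> 0\<close>
      by (intro hausdorff_Cantelli) (auto simp: U_def top.not_eq_extremum split: prod.split)
    moreover have "{i. x \<in> U \<alpha> i} = {(p, r, q). admissible_box K (p, r, q) \<and>
        \<bar>x - of_int p / of_int q\<bar> < \<Psi> (of_int q) \<and>
        \<bar>f (of_int p / of_int q) + \<alpha> - of_int r / of_int q\<bar> < C * \<Psi> (of_int q)}" for x
      by (auto simp: U_def E_def dist_real_def abs_minus_commute algebra_simps split: if_splits)
    ultimately show ?case by simp
  qed
qed

section \<open>From \<open>W\<close> to resonant triples\<close>

text \<open>The derivative is continuous, hence bounded on the compact interval; the mean value
  inequality does the rest.\<close>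

lemma poly_locally_lipschitz:
  fixes p :: "real poly"
  obtains L where "L \<ge> 0" "\<And>x y. x \<in> {-R..R} \<Longrightarrow> y \<in> {-R..R} \<Longrightarrow>
    \<bar>poly p x - poly p y\<bar> \<le> L * \<bar>x - y\<bar>"
proof -
  have "compact (poly (pderiv p) ` {-R..R})"
    by (intro compact_continuous_image compact_Icc continuous_intros)
  then obtain L where L: "L > 0" "\<And>x. x \<in> {-R..R} \<Longrightarrow> \<bar>poly (pderiv p) x\<bar> \<le> L"
    using compact_imp_bounded bounded_pos by (metis (no_types, lifting) imageI real_norm_def)
  have "norm (poly p x - poly p y) \<le> L * norm (x - y)" if "x \<in> {-R..R}" "y \<in> {-R..R}" for x y
    using that
    by (intro field_differentiable_bound[of "{-R..R}" _ "poly (pderiv p)"])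
       (auto intro!: L(2)[unfolded atLeastAtMost_iff] DERIV_subset[OF poly_DERIV])
  with L(1) show thesis by (intro that[of L]) auto
qed

text \<open>Restrict both \<open>x\<close> and \<alpha> to \<open>[-N, N]\<close>. There every
  triple admissible for \<open>x\<close> lies in one fixed box and is resonant with constant
  \<open>L + 1\<close>, so the previous almost-everywhere statement applies; countably many
  \<open>N\<close> exhaust the line.\<close>

lemma AE_hausdorff_measure_W_0:
  fixes P :: "int poly" and \<Psi> :: "real \<Rightarrow> real"
  assumes pos: "\<And>x. x > 0 \<Longrightarrow> \<Psi> x > 0" and anti: "antimono_on {0<..} \<Psi>" and "s \<ge> 0"
    and sum: "summable (\<lambda>n. real (Suc n) ^ 2 * \<Psi> (real (Suc n)) powr (1 + s))"
  shows "AE \<alpha> in lebesgue. hausdorff_measure s (W \<Psi> P \<alpha>) = 0"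
proof -
  let ?f = "poly (map_poly real_of_int P)"
  \<comment> \<open>Since \<Psi> decreases, \<open>B\<close> bounds \<Psi>(q) for all
    \<open>q \<ge> 1\<close>; thus \<open>p/q\<close> stays within \<open>R = N + B\<close> of 0
    when \<open>x\<close> is in \<open>[-N, N]\<close>.\<close>
  define B where "B = \<Psi> 1"
  have B: "\<Psi> (of_int q) \<le> B" if "q \<ge> 1" for q
    unfolding B_def by (rule monotone_onD[OF anti]) (use that in auto)
  have "AE \<alpha> in lborel. \<bar>\<alpha>\<bar> \<le> real N \<longrightarrow> hausdorff_measure s (W \<Psi> P \<alpha> \<inter> {-real N..real N}) = 0" for N
  proof -
    define R where "R = real N + B"
    have "B > 0" by (simp add: B_def pos)
    obtain L where L: "L \<ge> 0" "\<And>x y. x \<in> {-R..R} \<Longrightarrow> y \<in> {-R..R} \<Longrightarrow>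
        \<bar>?f x - ?f y\<bar> \<le> L * \<bar>x - y\<bar>"
      using poly_locally_lipschitz[of R "map_poly real_of_int P"] by blast
    define M where "M = \<bar>?f 0\<bar> + L * R"
    have M: "\<bar>?f x\<bar> \<le> M" if "x \<in> {-R..R}" for x
    proof -
      have "\<bar>?f x - ?f 0\<bar> \<le> L * \<bar>x - 0\<bar>" using that by (intro L(2)) auto
      also have "\<dots> \<le> L * R" using that L(1) by (intro mult_left_mono) auto
      finally show ?thesis by (simp add: M_def)
    qed
    \<comment> \<open>\<open>R\<close> bounds \<open>p/q\<close> in absolute value, and
      \<open>M + R = M + N + B\<close> bounds \<open>r/q\<close>, which is within \<Psi>(q) of P(x)
      + \<alpha>.\<close>
    define K where "K = max 1 \<lceil>max R (M + R)\<rceil>"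
    have K: "K \<ge> 1" "R \<le> of_int K" "M + R \<le> of_int K" unfolding K_def by linarith+
    have bound: "\<bar>n\<bar> \<le> K * q" if "q \<ge> 1" "\<bar>real_of_int n / of_int q\<bar> \<le> of_int K" for n q
    proof -
      have "real_of_int \<bar>n\<bar> \<le> real_of_int (K * q)"
        using that by (simp add: abs_divide divide_le_eq split: if_splits)
      then show ?thesis by (simp only: of_int_le_iff)
    qed
    have "AE \<alpha> in lborel. hausdorff_measure s
      {x. infinite {(p, r, q). admissible_box K (p, r, q) \<and> \<bar>x - of_int p / of_int q\<bar> < \<Psi> (of_int q) \<and>
        \<bar>?f (of_int p / of_int q) + \<alpha> - of_int r / of_int q\<bar> < (L + 1) * \<Psi> (of_int q)}} = 0"
      using assms L K by (intro AE_hausdorff_measure_resonant_0) auto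
    then show ?thesis
    proof eventually_elim
      case (elim \<alpha>)
      show ?case
      proof
        assume \<alpha>: "\<bar>\<alpha>\<bar> \<le> real N"
        show "hausdorff_measure s (W \<Psi> P \<alpha> \<inter> {-real N..real N}) = 0"
        proof (rule hausdorff_measure_0_mono[OF elim], safe)
          fix x assume x: "x \<in> W \<Psi> P \<alpha>" "x \<in> {-real N..real N}"
          let ?S = "{(p, r, q). admissible_box K (p, r, q) \<and> \<bar>x - of_int p / of_int q\<bar> < \<Psi> (of_int q) \<and>
            \<bar>?f (of_int p / of_int q) + \<alpha> - of_int r / of_int q\<bar> < (L + 1) * \<Psi> (of_int q)}"
          let ?T = "{(p::int, r::int, q::int). q \<ge> 1 \<and>
            \<bar>x - of_int p / of_int q\<bar> < \<Psi> (of_int q) \<and> \<bar>?f x + \<alpha> - of_int r / of_int q\<bar> < \<Psi> (of_int q)}"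
          have "?T \<subseteq> ?S"
          proof (safe)
            fix p r q :: int
            define y z where "y = real_of_int p / of_int q" and "z = real_of_int r / of_int q"
            assume q: "q \<ge> 1" and "\<bar>x - of_int p / of_int q\<bar> < \<Psi> (of_int q)"
              and "\<bar>?f x + \<alpha> - of_int r / of_int q\<bar> < \<Psi> (of_int q)"
            then have 1: "\<bar>x - y\<bar> < \<Psi> (of_int q)" and 2: "\<bar>?f x + \<alpha> - z\<bar> < \<Psi> (of_int q)"
              by (simp_all add: y_def z_def)
            have xR: "x \<in> {-R..R}" using x(2) \<open>B > 0\<close> by (auto simp: R_def)
            have yR: "y \<in> {-R..R}" using x(2) 1 B[OF q] by (auto simp: R_def)
            have "\<bar>y\<bar> \<le> of_int K" using yR K(2) by (simp add: abs_le_iff)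
            moreover have "\<bar>z\<bar> \<le> of_int K"
              using M[OF xR] \<alpha> 2 B[OF q] K(3) unfolding R_def by linarith
            ultimately show "admissible_box K (p, r, q)"
              using q by (auto simp: admissible_box_def y_def z_def intro!: bound)
            \<comment> \<open>Replacing \<open>x\<close> by \<open>p/q\<close> in the second
              inequality costs at most L \<Psi>(q), hence the constant \<open>L + 1\<close>. The set
              of admissible \<alpha> then no longer depends on \<open>x\<close>.\<close>
            have "\<bar>?f y - ?f x\<bar> \<le> L * \<Psi> (of_int q)"
              using L(2)[OF yR xR] mult_left_mono[OF less_imp_le[OF 1] L(1)]
              by (simp add: abs_minus_commute)
            then have "\<bar>?f y + \<alpha> - z\<bar> < (L + 1) * \<Psi> (of_int q)"
              using 2 by (simp add: distrib_right)
            then show "\<bar>?f (of_int p / of_int q) + \<alpha> - of_int r / of_int q\<bar> < (L + 1) * \<Psi> (of_int q)"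
              by (simp add: y_def z_def)
          qed
          moreover have "infinite ?T" using x(1) by (simp add: W_def)
          moreover assume "finite ?S"
          ultimately show False using finite_subset by blast
        qed
      qed
    qed
  qed
  then have "AE \<alpha> in lborel. \<forall>N. \<bar>\<alpha>\<bar> \<le> real N \<longrightarrow>
      hausdorff_measure s (W \<Psi> P \<alpha> \<inter> {-real N..real N}) = 0"
    by (simp add: AE_all_countable)
  then have "AE \<alpha> in lborel. hausdorff_measure s (W \<Psi> P \<alpha>) = 0"
  proof eventually_elim
    case (elim \<alpha>)
    \<comment> \<open>The pieces start at \<open>n0\<close> so that every one of them satisfies the
      restriction on \<alpha>; they still exhaust \<open>W\<close>.\<close>
    define n0 where "n0 = nat \<lceil>\<bar>\<alpha>\<bar>\<rceil>"
    have n0: "\<bar>\<alpha>\<bar> \<le> real n0" unfolding n0_def by linarith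
    have "hausdorff_measure s (\<Union>n. W \<Psi> P \<alpha> \<inter> {-real (n + n0)..real (n + n0)}) = 0"
      using n0 by (intro hausdorff_measure_0_UN elim[rule_format]) simp
    moreover have "W \<Psi> P \<alpha> \<subseteq> (\<Union>n. W \<Psi> P \<alpha> \<inter> {-real (n + n0)..real (n + n0)})"
    proof
      fix x assume "x \<in> W \<Psi> P \<alpha>"
      moreover have "\<bar>x\<bar> \<le> real (nat \<lceil>\<bar>x\<bar>\<rceil> + n0)" by linarith
      ultimately show "x \<in> (\<Union>n. W \<Psi> P \<alpha> \<inter> {-real (n + n0)..real (n + n0)})"
        by (auto simp: abs_le_iff intro!: exI[of _ "nat \<lceil>\<bar>x\<bar>\<rceil>"])
    qed
    ultimately show ?case by (rule hausdorff_measure_0_mono)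
  qed
  then show ?thesis by (rule AE_completion)
qed

section \<open>The dimension bound and the conclusion\<close>

text \<open>The exponents above \<open>t\<close> are sampled along a sequence, so that for varying
  \<alpha> only countably many exceptional null sets have to be united.\<close>

lemma hausdorff_dim_le:
  assumes "t \<ge> 0" "\<And>n. hausdorff_measure (t + 1 / real (Suc n)) A = 0"
  shows "hausdorff_dim A \<le> ereal t"
proof (rule tendsto_lowerbound)
  show "(\<lambda>n. ereal (t + 1 / real (Suc n))) \<longlonglongrightarrow> ereal t"
    using tendsto_add[OF tendsto_const LIMSEQ_inverse_real_of_nat, of t]
    by (simp add: inverse_eq_divide)
  show "\<forall>\<^sub>F n in sequentially. hausdorff_dim A \<le> ereal (t + 1 / real (Suc n))"
  proof (intro always_eventually allI)
    fix n
    show "hausdorff_dim A \<le> ereal (t + 1 / real (Suc n))"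
      unfolding hausdorff_dim_def using assms by (intro Inf_lower) (auto intro!: exI)
  qed
qed simp

theorem corollary1p7:
  fixes P :: "int poly" and d :: nat and \<Psi> :: "real \<Rightarrow> real"
  assumes "degree P = d" and "d \<ge> 2"
    and "\<And>x. x > 0 \<Longrightarrow> \<Psi> x > 0"
    and "antimono_on {0<..} \<Psi>"
    and "(\<Psi> \<longlongrightarrow> 0) at_top"
  shows "(lower_order_inverse \<Psi> > ereal (real d + 1) \<longrightarrow>
            (AE \<alpha> in lebesgue. W \<Psi> P \<alpha> = {})) \<and>
         (ereal (real d) < lower_order_inverse \<Psi> \<and> lower_order_inverse \<Psi> \<le> ereal (real d + 1) \<longrightarrow>
            (AE \<alpha> in lebesgue. hausdorff_dim (W \<Psi> P \<alpha>) \<le>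
               (ereal (real d + 1) - lower_order_inverse \<Psi>) / lower_order_inverse \<Psi>))"
proof -
  have null: "AE \<alpha> in lebesgue. hausdorff_measure s (W \<Psi> P \<alpha>) = 0"
    if "s \<ge> 0" "ereal (3 / (1 + s)) < lower_order_inverse \<Psi>" for s
    using that assms by (intro AE_hausdorff_measure_W_0 summable_lower_order) auto
  have d3: "real d + 1 \<ge> 3" using \<open>d \<ge> 2\<close> by simp
  show ?thesis
  proof (intro conjI impI)
    assume "lower_order_inverse \<Psi> > ereal (real d + 1)"
    \<comment> \<open>The case \<open>s = 0\<close>: zero counting measure means emptiness, and the
      required threshold is 3 \<le> d + 1.\<close>
    then have "ereal (3 / (1 + 0)) < lower_order_inverse \<Psi>"
      using d3 by (intro le_less_trans[of "ereal (3 / (1 + 0))"]) auto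
    then have "AE \<alpha> in lebesgue. hausdorff_measure 0 (W \<Psi> P \<alpha>) = 0" by (intro null) auto
    then show "AE \<alpha> in lebesgue. W \<Psi> P \<alpha> = {}"
      by eventually_elim (rule empty_if_hausdorff_measure_0_eq_0)
  next
    assume *: "ereal (real d) < lower_order_inverse \<Psi> \<and> lower_order_inverse \<Psi> \<le> ereal (real d + 1)"
    then obtain l where l: "lower_order_inverse \<Psi> = ereal l"
      by (cases "lower_order_inverse \<Psi>") auto
    with * have dl: "real d < l" "l \<le> real d + 1" by auto
    define t where "t = (real d + 1 - l) / l"
    have l0: "l > 0" using dl by simp
    have t0: "t \<ge> 0" using dl l0 by (simp add: t_def)
    have "AE \<alpha> in lebesgue. hausdorff_measure (t + 1 / real (Suc n)) (W \<Psi> P \<alpha>) = 0" for n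
    proof (rule null)
      \<comment> \<open>The value of \<open>t\<close> is the solution of
        \<open>l * (1 + t) = d + 1\<close>. The excess \<open>l / (n + 1)\<close> makes the
        comparison with 3 strict even when \<open>d = 2\<close>.\<close>
      have "l * (1 + (t + 1 / real (Suc n))) = real d + 1 + l / real (Suc n)"
        using l0 by (simp add: t_def distrib_left)
      also have "\<dots> > 3" using l0 d3 add_le_less_mono[of 3 "real d + 1" 0 "l / real (Suc n)"] by simp
      finally show "ereal (3 / (1 + (t + 1 / real (Suc n)))) < lower_order_inverse \<Psi>"
        using t0 by (simp add: l pos_divide_less_eq add_nonneg_pos add_pos_nonneg)
    qed (use t0 in simp)
    then have "AE \<alpha> in lebesgue. \<forall>n. hausdorff_measure (t + 1 / real (Suc n)) (W \<Psi> P \<alpha>) = 0"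
      by (simp add: AE_all_countable)
    then have "AE \<alpha> in lebesgue. hausdorff_dim (W \<Psi> P \<alpha>) \<le> ereal t"
      by eventually_elim (rule hausdorff_dim_le[OF t0], blast)
    moreover have "(ereal (real d + 1) - lower_order_inverse \<Psi>) / lower_order_inverse \<Psi> = ereal t"
      using l0 by (simp add: l t_def)
    ultimately show "AE \<alpha> in lebesgue. hausdorff_dim (W \<Psi> P \<alpha>) \<le>
        (ereal (real d + 1) - lower_order_inverse \<Psi>) / lower_order_inverse \<Psi>"
      by simp
  qed
qed

end
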